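(* Let $\kappa_1,\kappa_2,\kappa_3,\kappa_4$ be arbitrary parameters, let $K$ be an algebraic closure of $\mathbb{C}(\kappa_1,\dots,\kappa_4)$, and consider the non-abelian system (with $z$ a central parameter) $$\frac{du}{dt}=P_1(u,v),\qquad\frac{dv}{dt}=P_2(u,v)+\kappa_4zu^{-2}\qquad(\ast)$$ where, with $a_1,a_2,b_1,b_2,c_1\in K$, $$P_1=a_1u^2v+(2-a_1-a_2)uvu+a_2vu^2+\kappa_1u+\kappa_2u^2,$$ $$P_2=b_1uv^2-(2+b_1+b_2)vuv+b_2v^2u-\kappa_1v+c_1uv+(-2\kappa_2-c_1)vu-\kappa_3 .$$ There are exactly six systems $(\ast)$ having a non-abelian first integral of the form $$\begin{aligned}J=\;&d_1u^2v^2+d_2uv^2u+d_3uvuv+d_4vu^2v+d_5vuvu+\Big(1-\sum_{i=1}^5d_i\Big)v^2u^2+e_1uv+(\kappa_1-e_1)vu\\&+h_1u^2v+(\kappa_2-h_1-h_2)uvu+h_2vu^2+\kappa_3u+\kappa_4zu^{-1}\end{aligned}$$ (for some $d_i,e_1,h_1,h_2\in K$). They are: (1) $P_1=2uvu+\kappa_1u+\kappa_2u^2$, $P_2=-2vuv-\kappa_1v-2\kappa_2vu-\kappa_3$, with $J=vu^2v+\kappa_1vu+\kappa_3\kappa_2^{-1}[u,v]+\kappa_2vu^2+\kappa_3u+\kappa_4zu^{-1}$; (2) $P_1=2uvu+\kappa_1u+\kappa_2u^2$, $P_2=-2vuv-\kappa_1v-2\kappa_2uv-\kappa_3$, with $J=vu^2v+\kappa_1uv+\kappa_3\kappa_2^{-1}[v,u]+\kappa_2u^2v+\kappa_3u+\kappa_4zu^{-1}$;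 (3) $P_1=uvu+vu^2+\kappa_1u+\kappa_2u^2$, $P_2=-vuv-v^2u-\kappa_1v-\kappa_2uv-\kappa_2vu-\kappa_3$, with $J=vuvu+\kappa_1vu+\kappa_2uvu+\kappa_3u+\kappa_4zu^{-1}$; (4) $P_1=uvu+vu^2+\kappa_1u+\kappa_2u^2$, $P_2=-vuv-v^2u-\kappa_1v-2\kappa_2vu-\kappa_3$, with $J=vuvu+\kappa_1vu+\kappa_2vu^2+\kappa_3u+\kappa_4zu^{-1}$; (5) $P_1=u^2v+uvu+\kappa_1u+\kappa_2u^2$, $P_2=-uv^2-vuv-\kappa_1v-\kappa_2uv-\kappa_2vu-\kappa_3$, with $J=uvuv+\kappa_1uv+\kappa_2uvu+\kappa_3u+\kappa_4zu^{-1}$; (6) $P_1=u^2v+uvu+\kappa_1u+\kappa_2u^2$, $P_2=-uv^2-vuv-\kappa_1v-2\kappa_2uv-\kappa_3$, with $J=uvuv+\kappa_1uv+\kappa_2u^2v+\kappa_3u+\kappa_4zu^{-1}$.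
   Context: "Arbitrary parameters" means that $\kappa_1,\dots,\kappa_4$ are algebraically independent indeterminates over $\mathbb{C}$. Here $\mathcal{A}=K[z]\langle u,u^{-1},v\rangle$ is the unital associative algebra freely generated by an invertible element $u$ and an element $v$; $z$ is a central indeterminate, and the coefficients of the system and of the integral do not depend on $z$; $[x,y]=xy-yx$. A system $du/dt=F_1,\ dv/dt=F_2$ with $F_1,F_2\in\mathcal{A}$ denotes the $K[z]$-linear derivation $d_t$ of $\mathcal{A}$ with $d_t(u)=F_1$, $d_t(v)=F_2$ (hence $d_t(u^{-1})=-u^{-1}F_1u^{-1}$). An element $J\in\mathcal{A}$ is a non-abelian first integral if $d_t(J)=0$ in $\mathcal{A}$. (The system $(\ast)$ is the auxiliary autonomous system of the non-abelian Painlevé-$3'(D_7)$ system $zu'=P_1$, $zv'=P_2+\kappa_4zu^{-2}$.) *)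

theory Defs
  imports
    "HOL-Library.Poly_Mapping"
    "HOL-Algebra.Algebraic_Closure_Type"
    "HOL-Computational_Algebra.Computational_Algebra"
begin

text \<open>
  The monoid generated by an invertible element \<open>u\<close> and an element \<open>v\<close>. Every element has a
  unique normal form \<open>u^n\<^sub>0 v u^n\<^sub>1 v \<dots> v u^n\<^sub>k\<close> with integer exponents: \<open>UPow n\<close> is \<open>u^n\<close> and
  \<open>UPowV n w\<close> is \<open>u^n v w\<close>. The operation is written additively because the convolution product
  on \<^typ>\<open>'a \<Rightarrow>\<^sub>0 'b\<close> is that of the monoid algebra of an additively written monoid.
\<close>

datatype umon = UPow int | UPowV int umon

instantiation umon :: monoid_add
begin

definition zero_umon :: umon where
  "zero_umon = UPow 0"

fun plus_umon :: "umon \<Rightarrow> umon \<Rightarrow> umon" where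
  "plus_umon (UPow n) (UPow m) = UPow (n + m)"
| "plus_umon (UPow n) (UPowV m w) = UPowV (n + m) w"
| "plus_umon (UPowV n w) x = UPowV n (plus_umon w x)"

instance
proof
  fix a b c :: umon
  show "a + b + c = a + (b + c)"
  proof (induction a)
    case (UPow n)
    show ?case by (cases b; cases c) (simp_all add: add.assoc)
  qed simp
  show "0 + a = a"
    by (cases a) (simp_all add: zero_umon_def)
  show "a + 0 = a"
    by (induction a) (simp_all add: zero_umon_def)
qed

end

text \<open>
  The free algebra \<open>k[z]\<langle>u, u\<^sup>-\<^sup>1, v\<rangle>\<close>, as the monoid algebra of \<^typ>\<open>umon\<close> over the polynomial ring
  \<open>k[z]\<close>.
\<close>

type_synonym 'k uvalg = "umon \<Rightarrow>\<^sub>0 'k poly"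

definition scal :: "'k::field poly \<Rightarrow> 'k uvalg" where
  "scal p = Poly_Mapping.single 0 p"

definition smul :: "'k::field \<Rightarrow> 'k uvalg \<Rightarrow> 'k uvalg" (infixr "\<cdot>" 75) where
  "c \<cdot> x = scal [:c:] * x"

definition z :: "'k::field uvalg" where
  "z = scal [:0, 1:]"

definition u :: "'k::field uvalg" where
  "u = Poly_Mapping.single (UPow 1) 1"

definition uinv :: "'k::field uvalg" where
  "uinv = Poly_Mapping.single (UPow (- 1)) 1"

definition v :: "'k::field uvalg" where
  "v = Poly_Mapping.single (UPowV 0 (UPow 0)) 1"

lemma u_uinv: "u * uinv = 1" "uinv * u = 1"
  by (simp_all add: u_def uinv_def mult_single flip: zero_umon_def)

definition is_derivation :: "('k::field uvalg \<Rightarrow> 'k uvalg) \<Rightarrow> bool" where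
  "is_derivation D \<longleftrightarrow>
     (\<forall>x y. D (x + y) = D x + D y) \<and>
     (\<forall>p x. D (scal p * x) = scal p * D x) \<and>
     (\<forall>x y. D (x * y) = D x * y + x * D y)"

definition system_derivation :: "'k::field uvalg \<Rightarrow> 'k uvalg \<Rightarrow> 'k uvalg \<Rightarrow> 'k uvalg" where
  "system_derivation F1 F2 = (THE D. is_derivation D \<and> D u = F1 \<and> D v = F2)"

lemma uvalg_induct [case_names single sum]:
  fixes x :: "'k::field uvalg"
  assumes "\<And>w p. P (Poly_Mapping.single w p)" and "\<And>x y. P x \<Longrightarrow> P y \<Longrightarrow> P (x + y)"
  shows "P x"
proof (induction x rule: update_induct)
  case const
  show ?case using assms(1)[of 0 0] by simp
next
  case (update f w p)
  have "Poly_Mapping.update w p f = f + Poly_Mapping.single w p"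
    using update.hyps(1)
    by (intro poly_mapping_eqI) (auto simp: lookup_add lookup_update lookup_single in_keys_iff)
  then show ?case using update assms by simp
qed

lemma scal_central: "scal p * x = x * scal p"
  for x :: "'k::field uvalg"
proof (induction x rule: uvalg_induct)
  case (single k c)
  show ?case by (simp add: scal_def mult_single mult.commute)
next
  case (sum f g)
  then show ?case by (simp add: algebra_simps)
qed

lemma uvalg_single: "Poly_Mapping.single m p = scal p * Poly_Mapping.single m (1 :: 'k::field poly)"
  by (simp add: scal_def mult_single)

lemma derivation_unique:
  fixes D E :: "'k::field uvalg \<Rightarrow> 'k uvalg"
  assumes D: "is_derivation D" and E: "is_derivation E"
    and u: "D u = E u" and v: "D v = E v"
  shows "D = E"
proof
  have D': "D (x + y) = D x + D y" "D (scal p * x) = scal p * D x" "D (x * y) = D x * y + x * D y"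
    and E': "E (x + y) = E x + E y" "E (scal p * x) = scal p * E x" "E (x * y) = E x * y + x * E y"
    for x y p using D E unfolding is_derivation_def by blast+
  have D1: "D 1 = 0" using D'(3)[of 1 1] by simp
  have E1: "E 1 = 0" using E'(3)[of 1 1] by simp
  have ui: "D uinv = E uinv"
  proof -
    have inv: "G uinv = - uinv * G u * uinv" if "\<And>x y. G (x * y) = G x * y + x * G y" "G 1 = 0"
      for G :: "'k uvalg \<Rightarrow> 'k uvalg"
    proof -
      have "0 = uinv * G (u * uinv)" using that(2) by (simp add: u_uinv)
      also have "\<dots> = uinv * G u * uinv + (uinv * u) * G uinv"
        by (simp add: that(1) distrib_left mult.assoc)
      also have "\<dots> = uinv * G u * uinv + G uinv"
        by (simp add: u_uinv)
      finally show ?thesis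
        by (simp add: eq_neg_iff_add_eq_0 add.commute)
    qed
    show ?thesis using inv[of D] inv[of E] D'(3) E'(3) D1 E1 u by simp
  qed
  let ?m = "\<lambda>w. Poly_Mapping.single w (1 :: 'k poly)"
  have pow: "D (?m (UPow n)) = E (?m (UPow n))" for n
  proof (induction n rule: int_induct[where k = 0])
    case base
    show ?case using D1 E1 by (simp flip: zero_umon_def)
  next
    case (step1 i)
    have "?m (UPow (i + 1)) = ?m (UPow i) * u" by (simp add: u_def mult_single)
    then show ?case using step1 u by (simp add: D' E')
  next
    case (step2 i)
    have "?m (UPow (i - 1)) = ?m (UPow i) * uinv" by (simp add: uinv_def mult_single)
    then show ?case using step2 ui by (simp add: D' E')
  qed
  have mon: "D (?m w) = E (?m w)" for w
  proof (induction w)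
    case (UPow n)
    show ?case by (rule pow)
  next
    case (UPowV n w)
    have "UPow 0 + w = w" using add_0_left[of w] by (simp only: zero_umon_def)
    then have "?m (UPowV n w) = ?m (UPow n) * (v * ?m w)" by (simp add: v_def mult_single)
    then show ?case using UPowV pow[of n] v by (simp add: D' E')
  qed
  fix x show "D x = E x"
  proof (induction x rule: uvalg_induct)
    case (single k c)
    show ?case by (subst (1 2) uvalg_single) (simp add: D'(2) E'(2) mon)
  next
    case (sum f g)
    then show ?case by (simp add: D' E')
  qed
qed

lemma derivation_exists:
  fixes F1 F2 :: "'k::field uvalg"
  shows "\<exists>D. is_derivation D \<and> D u = F1 \<and> D v = F2"
proof -
  let ?m = "\<lambda>w. Poly_Mapping.single w (1 :: 'k poly)"
  let ?U = "\<lambda>n. ?m (UPow n)"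
  have UU: "?U n * ?U m = ?U (n + m)" for n m by (simp add: mult_single)
  have U0: "?U 0 = 1" by (simp flip: zero_umon_def)
  define h where "h n = ?U (- n - 1) * F1 * ?U n" for n
  define c where "c n = sum h {0..<n} - sum h {n..<0}" for n
  define g where "g n = ?U n * c n" for n
  have c_step: "c (n + 1) = c n + h n" for n
  proof (cases "n \<ge> 0")
    case True
    then have "{0..<n + 1} = insert n {0..<n}" by auto
    then show ?thesis using True by (simp add: c_def)
  next
    case False
    then have "{n..<0} = insert n {n + 1..<0}" by auto
    then show ?thesis using False by (simp add: c_def)
  qed
  have h_shift: "h (n + m) = ?U (- m) * h n * ?U m" for n m
  proof -
    have "?U (- m) * h n * ?U m = (?U (- m) * ?U (- n - 1)) * F1 * (?U n * ?U m)"
      by (simp only: h_def mult.assoc)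
    then show ?thesis by (simp add: UU h_def algebra_simps)
  qed
  have c_add: "c (n + m) = ?U (- m) * c n * ?U m + c m" for n m
  proof (induction n rule: int_induct[where k = 0])
    case base
    show ?case by (simp add: c_def)
  next
    case (step1 i)
    have "c (i + 1 + m) = c (i + m) + h (i + m)" using c_step[of "i + m"] by (simp add: add_ac)
    then show ?case
      using step1 by (simp only: c_step[of i] h_shift[of i]) (simp add: distrib_left distrib_right)
  next
    case (step2 i)
    have "c (i - 1 + m) = c (i + m) - h (i - 1 + m)" using c_step[of "i - 1 + m"]
      by (simp add: algebra_simps)
    moreover have "c (i - 1) = c i - h (i - 1)" using c_step[of "i - 1"] by simp
    ultimately show ?case
      using step2 by (simp only: h_shift[of "i - 1"]) (simp add: left_diff_distrib right_diff_distrib)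
  qed
  have g_add: "g (n + m) = g n * ?U m + ?U n * g m" for n m
  proof -
    have "?U (n + m) * (?U (- m) * c n * ?U m) = (?U (n + m) * ?U (- m)) * c n * ?U m"
      by (simp only: mult.assoc)
    then have "?U (n + m) * (?U (- m) * c n * ?U m) = ?U n * c n * ?U m"
      by (simp add: UU)
    moreover have "?U (n + m) * c m = ?U n * (?U m * c m)"
      by (simp add: UU flip: mult.assoc)
    ultimately show ?thesis by (simp add: g_def c_add distrib_left mult.assoc)
  qed
  define e where "e = rec_umon g (\<lambda>n w r. (g n * v + ?U n * F2) * ?m w + ?U n * v * r)"
  have e_simps: "e (UPow n) = g n"
    "e (UPowV n w) = (g n * v + ?U n * F2) * ?m w + ?U n * v * e w" for n w
    by (simp_all add: e_def)
  have mm: "?m x * ?m y = ?m (x + y)" for x y by (simp add: mult_single)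
  have UV: "?m (UPowV n w) = ?U n * v * ?m w" for n w
  proof -
    have "UPow 0 + w = w" using add_0_left[of w] by (simp only: zero_umon_def)
    then show ?thesis by (simp add: v_def mult_single)
  qed
  have e_add: "e (x + y) = e x * ?m y + ?m x * e y" for x y
  proof (induction x)
    case (UPow n)
    show ?case
      by (cases y) (simp_all add: e_simps g_add UV UU[symmetric] distrib_left distrib_right mult.assoc add.assoc)
  next
    case (UPowV n w)
    then show ?case by (simp add: e_simps UV mm[symmetric] distrib_left distrib_right mult.assoc add.assoc)
  qed
  define D where "D x = (\<Sum>w\<in>Poly_Mapping.keys x. scal (Poly_Mapping.lookup x w) * e w)" for x
  have scal_add: "scal (p + q) = scal p + scal q" for p q :: "'k poly"
    by (simp add: scal_def single_add)
  have scal_mult: "scal (p * q) = scal p * scal q" for p q :: "'k poly"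
    by (simp add: scal_def mult_single)
  have D_sup: "D x = (\<Sum>w\<in>S. scal (Poly_Mapping.lookup x w) * e w)"
    if "finite S" "Poly_Mapping.keys x \<subseteq> S" for x S
    unfolding D_def using that
    by (intro sum.mono_neutral_left) (auto simp: in_keys_iff scal_def)
  have D_add: "D (x + y) = D x + D y" for x y
  proof -
    let ?S = "Poly_Mapping.keys x \<union> Poly_Mapping.keys y"
    have "Poly_Mapping.keys (x + y) \<subseteq> ?S" by (rule keys_add)
    then show ?thesis
      by (simp add: D_sup[of ?S] lookup_add scal_add distrib_right sum.distrib)
  qed
  have D_single: "D (Poly_Mapping.single w p) = scal p * e w" for w p
    by (subst D_sup[of "{w}"]) auto
  have D_scal: "D (scal p * x) = scal p * D x" for p x
  proof (induction x rule: uvalg_induct)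
    case (single k c)
    have "scal p * Poly_Mapping.single k c = Poly_Mapping.single k (p * c)"
      by (simp add: scal_def mult_single)
    then show ?case by (simp add: D_single scal_mult mult.assoc)
  qed (simp add: distrib_left D_add)
  have D_mult: "D (x * y) = D x * y + x * D y" for x y
  proof (induction x rule: uvalg_induct)
    case (single k p)
    show ?case
    proof (induction y rule: uvalg_induct)
      case (single l q)
      have swap: "scal p * scal q * (x * y) = (scal p * x) * (scal q * y)" for x y :: "'k uvalg"
      proof -
        have "scal p * scal q * (x * y) = scal p * (scal q * x) * y" by (simp only: mult.assoc)
        also have "\<dots> = scal p * (x * scal q) * y" by (simp only: scal_central[of q x])
        finally show ?thesis by (simp only: mult.assoc)
      qed
      have "D (Poly_Mapping.single k p * Poly_Mapping.single l q)
          = scal p * scal q * (e k * ?m l) + scal p * scal q * (?m k * e l)"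
        by (simp add: mult_single D_single e_add scal_mult distrib_left)
      also have "\<dots> = (scal p * e k) * (scal q * ?m l) + (scal p * ?m k) * (scal q * e l)"
        by (simp only: swap)
      finally show ?case by (simp only: D_single uvalg_single[symmetric])
    qed (simp add: algebra_simps D_add)
  qed (simp add: algebra_simps D_add)
  have c1: "c 1 = h 0" using c_step[of 0] by (simp add: c_def)
  have "g 1 = (?U 1 * ?U (- 1)) * F1"
    by (simp only: g_def c1 h_def mult.assoc minus_zero diff_0 U0 mult_1_right)
  then have "g 1 = F1" by (simp add: UU U0)
  moreover have "g 0 = 0" by (simp add: g_def c_def)
  ultimately have "D u = F1" "D v = F2"
    by (simp_all add: u_def v_def D_single e_simps U0 scal_def)
  then show ?thesis
    using D_add D_scal D_mult unfolding is_derivation_def by blast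
qed

lemma system_derivation_well_defined:
  fixes F1 F2 :: "'k::field uvalg"
  shows "\<exists>!D. is_derivation D \<and> D u = F1 \<and> D v = F2"
  using derivation_exists[of F1 F2] by (auto intro: derivation_unique)

definition first_integral :: "'k::field uvalg \<Rightarrow> 'k uvalg \<Rightarrow> 'k uvalg \<Rightarrow> bool" where
  "first_integral F1 F2 J \<longleftrightarrow> system_derivation F1 F2 J = 0"

text \<open>
  The algebraic closure of \<open>\<complex>(\<kappa>\<^sub>1, \<kappa>\<^sub>2, \<kappa>\<^sub>3, \<kappa>\<^sub>4)\<close>. The polynomial ring is \<open>\<complex>[\<kappa>\<^sub>4][\<kappa>\<^sub>3][\<kappa>\<^sub>2][\<kappa>\<^sub>1]\<close>, so
  \<open>\<kappa>\<^sub>1\<close> is the variable of the outermost \<^typ>\<open>'a poly\<close>.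
\<close>

type_synonym K = "complex poly poly poly poly fract alg_closure"

definition \<kappa>\<^sub>1 :: K where "\<kappa>\<^sub>1 = to_ac (to_fract [:0, 1:])"
definition \<kappa>\<^sub>2 :: K where "\<kappa>\<^sub>2 = to_ac (to_fract [:[:0, 1:]:])"
definition \<kappa>\<^sub>3 :: K where "\<kappa>\<^sub>3 = to_ac (to_fract [:[:[:0, 1:]:]:])"
definition \<kappa>\<^sub>4 :: K where "\<kappa>\<^sub>4 = to_ac (to_fract [:[:[:[:0, 1:]:]:]:])"

definition P1 :: "K \<Rightarrow> K \<Rightarrow> K uvalg" where
  "P1 a1 a2 = a1 \<cdot> (u^2 * v) + (2 - a1 - a2) \<cdot> (u * v * u) + a2 \<cdot> (v * u^2)
     + \<kappa>\<^sub>1 \<cdot> u + \<kappa>\<^sub>2 \<cdot> u^2"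

definition P2 :: "K \<Rightarrow> K \<Rightarrow> K \<Rightarrow> K uvalg" where
  "P2 b1 b2 c1 = b1 \<cdot> (u * v^2) - (2 + b1 + b2) \<cdot> (v * u * v) + b2 \<cdot> (v^2 * u)
     - \<kappa>\<^sub>1 \<cdot> v + c1 \<cdot> (u * v) + (- 2 * \<kappa>\<^sub>2 - c1) \<cdot> (v * u) - \<kappa>\<^sub>3 \<cdot> 1"

definition system :: "K uvalg \<Rightarrow> K uvalg \<Rightarrow> K uvalg \<times> K uvalg" where
  "system p1 p2 = (p1, p2 + \<kappa>\<^sub>4 \<cdot> (z * uinv^2))"

definition systems :: "(K uvalg \<times> K uvalg) set" where
  "systems = {system (P1 a1 a2) (P2 b1 b2 c1) | a1 a2 b1 b2 c1. True}"

definition integral_form ::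
  "K \<Rightarrow> K \<Rightarrow> K \<Rightarrow> K \<Rightarrow> K \<Rightarrow> K \<Rightarrow> K \<Rightarrow> K \<Rightarrow> K uvalg"
where
  "integral_form d1 d2 d3 d4 d5 e1 h1 h2 =
     d1 \<cdot> (u^2 * v^2) + d2 \<cdot> (u * v^2 * u) + d3 \<cdot> (u * v * u * v) + d4 \<cdot> (v * u^2 * v)
     + d5 \<cdot> (v * u * v * u) + (1 - (d1 + d2 + d3 + d4 + d5)) \<cdot> (v^2 * u^2)
     + e1 \<cdot> (u * v) + (\<kappa>\<^sub>1 - e1) \<cdot> (v * u)
     + h1 \<cdot> (u^2 * v) + (\<kappa>\<^sub>2 - h1 - h2) \<cdot> (u * v * u) + h2 \<cdot> (v * u^2)
     + \<kappa>\<^sub>3 \<cdot> u + \<kappa>\<^sub>4 \<cdot> (z * uinv)"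

definition integral_forms :: "K uvalg set" where
  "integral_forms = {integral_form d1 d2 d3 d4 d5 e1 h1 h2 | d1 d2 d3 d4 d5 e1 h1 h2. True}"

definition commutator :: "K uvalg \<Rightarrow> K uvalg \<Rightarrow> K uvalg" where
  "commutator x y = x * y - y * x"

definition listed :: "((K uvalg \<times> K uvalg) \<times> K uvalg) list" where
  "listed =
    [(system
        (2 \<cdot> (u * v * u) + \<kappa>\<^sub>1 \<cdot> u + \<kappa>\<^sub>2 \<cdot> u^2)
        (- (2 \<cdot> (v * u * v)) - \<kappa>\<^sub>1 \<cdot> v - (2 * \<kappa>\<^sub>2) \<cdot> (v * u) - \<kappa>\<^sub>3 \<cdot> 1),
      v * u^2 * v + \<kappa>\<^sub>1 \<cdot> (v * u) + (\<kappa>\<^sub>3 / \<kappa>\<^sub>2) \<cdot> commutator u v + \<kappa>\<^sub>2 \<cdot> (v * u^2)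
        + \<kappa>\<^sub>3 \<cdot> u + \<kappa>\<^sub>4 \<cdot> (z * uinv)),
     (system
        (2 \<cdot> (u * v * u) + \<kappa>\<^sub>1 \<cdot> u + \<kappa>\<^sub>2 \<cdot> u^2)
        (- (2 \<cdot> (v * u * v)) - \<kappa>\<^sub>1 \<cdot> v - (2 * \<kappa>\<^sub>2) \<cdot> (u * v) - \<kappa>\<^sub>3 \<cdot> 1),
      v * u^2 * v + \<kappa>\<^sub>1 \<cdot> (u * v) + (\<kappa>\<^sub>3 / \<kappa>\<^sub>2) \<cdot> commutator v u + \<kappa>\<^sub>2 \<cdot> (u^2 * v)
        + \<kappa>\<^sub>3 \<cdot> u + \<kappa>\<^sub>4 \<cdot> (z * uinv)),
     (system
        (u * v * u + v * u^2 + \<kappa>\<^sub>1 \<cdot> u + \<kappa>\<^sub>2 \<cdot> u^2)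
        (- (v * u * v) - v^2 * u - \<kappa>\<^sub>1 \<cdot> v - \<kappa>\<^sub>2 \<cdot> (u * v) - \<kappa>\<^sub>2 \<cdot> (v * u) - \<kappa>\<^sub>3 \<cdot> 1),
      v * u * v * u + \<kappa>\<^sub>1 \<cdot> (v * u) + \<kappa>\<^sub>2 \<cdot> (u * v * u) + \<kappa>\<^sub>3 \<cdot> u + \<kappa>\<^sub>4 \<cdot> (z * uinv)),
     (system
        (u * v * u + v * u^2 + \<kappa>\<^sub>1 \<cdot> u + \<kappa>\<^sub>2 \<cdot> u^2)
        (- (v * u * v) - v^2 * u - \<kappa>\<^sub>1 \<cdot> v - (2 * \<kappa>\<^sub>2) \<cdot> (v * u) - \<kappa>\<^sub>3 \<cdot> 1),
      v * u * v * u + \<kappa>\<^sub>1 \<cdot> (v * u) + \<kappa>\<^sub>2 \<cdot> (v * u^2) + \<kappa>\<^sub>3 \<cdot> u + \<kappa>\<^sub>4 \<cdot> (z * uinv)),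
     (system
        (u^2 * v + u * v * u + \<kappa>\<^sub>1 \<cdot> u + \<kappa>\<^sub>2 \<cdot> u^2)
        (- (u * v^2) - v * u * v - \<kappa>\<^sub>1 \<cdot> v - \<kappa>\<^sub>2 \<cdot> (u * v) - \<kappa>\<^sub>2 \<cdot> (v * u) - \<kappa>\<^sub>3 \<cdot> 1),
      u * v * u * v + \<kappa>\<^sub>1 \<cdot> (u * v) + \<kappa>\<^sub>2 \<cdot> (u * v * u) + \<kappa>\<^sub>3 \<cdot> u + \<kappa>\<^sub>4 \<cdot> (z * uinv)),
     (system
        (u^2 * v + u * v * u + \<kappa>\<^sub>1 \<cdot> u + \<kappa>\<^sub>2 \<cdot> u^2)
        (- (u * v^2) - v * u * v - \<kappa>\<^sub>1 \<cdot> v - (2 * \<kappa>\<^sub>2) \<cdot> (u * v) - \<kappa>\<^sub>3 \<cdot> 1),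
      u * v * u * v + \<kappa>\<^sub>1 \<cdot> (u * v) + \<kappa>\<^sub>2 \<cdot> (u^2 * v) + \<kappa>\<^sub>3 \<cdot> u + \<kappa>\<^sub>4 \<cdot> (z * uinv))]"

end

theory Submission
  imports Defs
begin

text \<open>
  Every coefficient of \<open>d\<^sub>t(J)\<close> has to vanish. The words containing \<open>u\<^sup>-\<^sup>1\<close> (where \<open>\<kappa>\<^sub>4 \<noteq> 0\<close> enters) express
  \<open>a\<^sub>1, a\<^sub>2\<close> through the \<open>d\<^sub>i\<close>, and the words of degree three in \<open>v\<close> then force \<open>b\<^sub>i = - a\<^sub>i\<close> and
  \<open>(a\<^sub>1, a\<^sub>2) \<in> {(0, 0), (1, 0), (0, 1)}\<close>. In each of the three cases the remaining words leave a quadratic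
  equation for \<open>c\<^sub>1\<close>, whose two roots are distinct because \<open>\<kappa>\<^sub>2 \<noteq> 0\<close>.
\<close>

text \<open>Characteristic zero is what allows the factors 2 in the coefficient equations over
  \<open>K\<close> to be cancelled.\<close>

instance fract :: ("{idom, ring_char_0}") field_char_0
proof
  have "(of_nat n :: 'a fract) = to_fract (of_nat n)" for n
    by (induction n) simp_all
  then show "inj (of_nat :: nat \<Rightarrow> 'a fract)"
    by (simp add: inj_def)
qed

section \<open>Scalars and words in the free algebra\<close>

lemma smul_simps:
  "c \<cdot> (x + y) = c \<cdot> x + c \<cdot> y" "(c + d) \<cdot> x = c \<cdot> x + d \<cdot> x"
  "c \<cdot> (x - y) = c \<cdot> x - c \<cdot> y" "(c - d) \<cdot> x = c \<cdot> x - d \<cdot> x"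
  "c \<cdot> (- x) = - (c \<cdot> x)" "(- c) \<cdot> x = - (c \<cdot> x)"
  "0 \<cdot> x = 0" "c \<cdot> 0 = 0" "1 \<cdot> x = x" "c \<cdot> d \<cdot> x = (c * d) \<cdot> x"
  "(c \<cdot> x) * y = c \<cdot> (x * y)" "x * (c \<cdot> y) = c \<cdot> (x * y)"
proof -
  have sc: "scal [:c + d:] = scal [:c:] + scal [:d:]" "scal [:c - d:] = scal [:c:] - scal [:d:]"
    "scal [:- c:] = - scal [:c:]" "scal [:0:] = 0" "scal [:1:] = 1"
    "scal [:c * d:] = scal [:c:] * scal [:d:]"
    by (simp_all add: scal_def mult_single mult.commute
        flip: single_add single_diff single_uminus single_one one_pCons)
  show "c \<cdot> (x + y) = c \<cdot> x + c \<cdot> y" "(c + d) \<cdot> x = c \<cdot> x + d \<cdot> x"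
    "c \<cdot> (x - y) = c \<cdot> x - c \<cdot> y" "(c - d) \<cdot> x = c \<cdot> x - d \<cdot> x"
    "c \<cdot> (- x) = - (c \<cdot> x)" "(- c) \<cdot> x = - (c \<cdot> x)"
    "0 \<cdot> x = 0" "c \<cdot> 0 = 0" "1 \<cdot> x = x" "c \<cdot> d \<cdot> x = (c * d) \<cdot> x"
    "(c \<cdot> x) * y = c \<cdot> (x * y)"
    unfolding smul_def sc by (simp_all add: algebra_simps)
  have "x * (scal [:c:] * y) = scal [:c:] * (x * y)"
    by (metis mult.assoc scal_central)
  then show "x * (c \<cdot> y) = c \<cdot> (x * y)"
    by (simp add: smul_def)
qed

text \<open>Splitting the scalar 2 into a sum lets equal words cancel by additive rewriting alone;
  products of scalars are covered with the 2 in last place.\<close>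

lemma smul_two:
  "2 \<cdot> x = x + x" "(c * 2) \<cdot> x = c \<cdot> x + c \<cdot> x" "(c * (d * 2)) \<cdot> x = (c * d) \<cdot> x + (c * d) \<cdot> x"
proof -
  show two: "2 \<cdot> x = x + x" for x :: "'a uvalg"
    using smul_simps(2)[of 1 1 x] by (simp add: smul_simps)
  show "(c * 2) \<cdot> x = c \<cdot> x + c \<cdot> x" for c
    by (simp add: smul_simps two flip: smul_simps(10))
  from this[of "c * d"] show "(c * (d * 2)) \<cdot> x = (c * d) \<cdot> x + (c * d) \<cdot> x"
    by (simp add: mult.assoc)
qed

lemma smul_single: "c \<cdot> Poly_Mapping.single w p = Poly_Mapping.single w (smult c p)"
  by (simp add: smul_def scal_def mult_single)

lemma smul_one: "c \<cdot> 1 = Poly_Mapping.single (UPow 0) [:c:]"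
  by (simp add: smul_def scal_def zero_umon_def)

lemma coeff_when: "coeff (p when b) n = (coeff p n when b)"
  by (simp add: when_def)

lemma lookup_smul: "Poly_Mapping.lookup (c \<cdot> x) w = smult c (Poly_Mapping.lookup x w)"
  by (induction x rule: uvalg_induct)
     (simp_all add: smul_single Poly_Mapping.lookup_single smul_simps Poly_Mapping.lookup_add
        smult_add_right when_def)

text \<open>Rewrite rules towards normal form: \<open>z\<close> moves to the left and
  \<open>u\<close> cancels against \<open>uinv\<close>. The versions with a trailing
  \<open>x\<close> are for right-associated products.\<close>

lemma word_simps:
  fixes x :: "'a::field uvalg"
  shows "u * uinv = (1 :: 'a uvalg)" "uinv * u = (1 :: 'a uvalg)"
    "u * (uinv * x) = x" "uinv * (u * x) = x"
    "u * z = z * (u :: 'a uvalg)" "u * (z * x) = z * (u * x)"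
    "uinv * z = z * (uinv :: 'a uvalg)" "uinv * (z * x) = z * (uinv * x)"
    "v * z = z * (v :: 'a uvalg)" "v * (z * x) = z * (v * x)"
proof -
  have c: "y * z = z * y" for y :: "'a uvalg"
    by (simp add: z_def scal_central)
  have c': "y * (z * x) = z * (y * x)" for y :: "'a uvalg"
    by (metis c mult.assoc)
  show "u * z = z * (u :: 'a uvalg)" "uinv * z = z * (uinv :: 'a uvalg)"
    "v * z = z * (v :: 'a uvalg)"
    by (rule c)+
  show "u * (z * x) = z * (u * x)" "uinv * (z * x) = z * (uinv * x)" "v * (z * x) = z * (v * x)"
    by (rule c')+
  show "u * uinv = (1 :: 'a uvalg)" "uinv * u = (1 :: 'a uvalg)"
    by (rule u_uinv)+
  then show "u * (uinv * x) = x" "uinv * (u * x) = x"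
    by (metis mult.assoc mult_1_left)+
qed

lemmas single_expand = distrib_left distrib_right left_diff_distrib right_diff_distrib
  mult_minus_left mult_minus_right smul_simps(5) u_def v_def uinv_def z_def scal_def mult_single
  smul_single smul_one zero_umon_def power2_eq_square

lemmas lookup_expand = Poly_Mapping.lookup_add lookup_minus lookup_uminus
  Poly_Mapping.lookup_single lookup_smul

text \<open>Unique existence resolves the definite description. The rule for \<open>uinv\<close>
  comes from differentiating \<open>u * uinv = 1\<close>; \<open>z\<close> is a scalar multiple of
  1, whose derivative is 0.\<close>

lemma system_derivation_simps:
  "system_derivation F1 F2 u = F1"
  "system_derivation F1 F2 v = F2"
  "system_derivation F1 F2 uinv = - (uinv * F1 * uinv)"
  "system_derivation F1 F2 z = 0"
  "system_derivation F1 F2 (x + y) = system_derivation F1 F2 x + system_derivation F1 F2 y"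
  "system_derivation F1 F2 (x - y) = system_derivation F1 F2 x - system_derivation F1 F2 y"
  "system_derivation F1 F2 (c \<cdot> x) = c \<cdot> system_derivation F1 F2 x"
  "system_derivation F1 F2 (x * y) = system_derivation F1 F2 x * y + x * system_derivation F1 F2 y"
proof -
  let ?D = "system_derivation F1 F2"
  have D: "is_derivation ?D \<and> ?D u = F1 \<and> ?D v = F2"
    unfolding system_derivation_def by (rule theI'[OF system_derivation_well_defined])
  then show u: "?D u = F1" and "?D v = F2"
    by blast+
  show add: "?D (x + y) = ?D x + ?D y" and "?D (c \<cdot> x) = c \<cdot> ?D x"
    and mult: "?D (x * y) = ?D x * y + x * ?D y" for x y
    using D by (auto simp: is_derivation_def smul_def)
  show "?D (x - y) = ?D x - ?D y"
    using add[of "x - y" y] by simp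
  have 1: "?D 1 = 0"
    using mult[of 1 1] by simp
  moreover have "?D (scal p * 1) = scal p * ?D 1" for p
    using D unfolding is_derivation_def by blast
  ultimately show "?D z = 0"
    by (simp add: z_def)
  have "0 = uinv * ?D (u * uinv)"
    by (simp add: u_uinv 1)
  also have "\<dots> = uinv * F1 * uinv + ?D uinv"
    by (simp add: mult u distrib_left mult.assoc word_simps(4))
  finally show "?D uinv = - (uinv * F1 * uinv)"
    by (simp add: eq_neg_iff_add_eq_0 add.commute)
qed

section \<open>Parametrisation of the systems\<close>

lemma \<kappa>_nonzero: "\<kappa>\<^sub>2 \<noteq> 0" "\<kappa>\<^sub>4 \<noteq> 0"
  by (simp_all add: \<kappa>\<^sub>2_def \<kappa>\<^sub>4_def)

definition param_system :: "K \<times> K \<times> K \<times> K \<times> K \<Rightarrow> K uvalg \<times> K uvalg" where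
  "param_system = (\<lambda>(a1, a2, b1, b2, c1). system (P1 a1 a2) (P2 b1 b2 c1))"

text \<open>The order is that of \<open>listed\<close>, so that the two lists can be compared entry
  by entry.\<close>

definition integrable_params :: "(K \<times> K \<times> K \<times> K \<times> K) list" where
  "integrable_params =
    [(0, 0, 0, 0, 0), (0, 0, 0, 0, - 2 * \<kappa>\<^sub>2), (0, 1, 0, - 1, - \<kappa>\<^sub>2), (0, 1, 0, - 1, 0),
     (1, 0, - 1, 0, - \<kappa>\<^sub>2), (1, 0, - 1, 0, - 2 * \<kappa>\<^sub>2)]"

lemma systems_eq_range: "systems = range param_system"
  by (simp add: systems_def param_system_def image_def)

text \<open>Each parameter is itself the coefficient of one word: \<open>a1\<close> of
  \<open>u^2 * v\<close>, \<open>a2\<close> of \<open>v * u^2\<close>, \<open>b1\<close> of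
  \<open>u * v^2\<close>, \<open>b2\<close> of \<open>v^2 * u\<close> and \<open>c1\<close> of
  \<open>u * v\<close>.\<close>

lemma inj_param_system: "inj param_system"
proof -
  have "Poly_Mapping.lookup (P1 a1 a2) (UPowV 2 (UPow 0)) = [:a1:]"
    "Poly_Mapping.lookup (P1 a1 a2) (UPowV 0 (UPow 2)) = [:a2:]" for a1 a2
    by (simp_all add: P1_def single_expand lookup_expand)
  moreover have "Poly_Mapping.lookup (P2 b1 b2 c1 + \<kappa>\<^sub>4 \<cdot> (z * uinv^2)) (UPowV 1 (UPowV 0 (UPow 0))) = [:b1:]"
    "Poly_Mapping.lookup (P2 b1 b2 c1 + \<kappa>\<^sub>4 \<cdot> (z * uinv^2)) (UPowV 0 (UPowV 0 (UPow 1))) = [:b2:]"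
    "Poly_Mapping.lookup (P2 b1 b2 c1 + \<kappa>\<^sub>4 \<cdot> (z * uinv^2)) (UPowV 1 (UPow 0)) = [:c1:]" for b1 b2 c1
    by (simp_all add: P2_def single_expand lookup_expand)
  ultimately show ?thesis
    unfolding inj_def param_system_def system_def by (auto; metis pCons_eq_iff)
qed

lemma distinct_integrable_params: "distinct integrable_params"
  by (simp add: integrable_params_def \<kappa>_nonzero)

lemma map_fst_listed: "map fst listed = map param_system integrable_params"
proof -
  have "\<kappa>\<^sub>2 - 2 * \<kappa>\<^sub>2 = - \<kappa>\<^sub>2"
    by (simp add: algebra_simps)
  then show ?thesis
    by (simp add: listed_def integrable_params_def param_system_def P1_def P2_def smul_simps(6-9)
        minus_diff_commute)
qed

section \<open>Verification of the six integrals\<close>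

text \<open>A direct computation. In the first two entries the commutator has derivative
  \<open>\<kappa>\<^sub>2\<close> times \<open>u^2 * v - 2uvu + v * u^2\<close>; the factor
  \<open>\<kappa>\<^sub>3 / \<kappa>\<^sub>2\<close> makes it cancel the terms that
  \<open>- \<kappa>\<^sub>3\<close> in the equation for \<open>v\<close> leaves behind.\<close>

lemma listed_first_integral: "\<forall>((F1, F2), J) \<in> set listed. first_integral F1 F2 J"
  unfolding listed_def first_integral_def system_def commutator_def power2_eq_square
  by (simp add: system_derivation_simps mult.assoc, intro conjI)
     (simp_all add: smul_simps smul_two algebra_simps word_simps \<kappa>_nonzero)

lemma listed_integral_forms: "snd ` set listed \<subseteq> integral_forms"
proof -
  \<comment> \<open>The parameters are read off the coefficients; in the first two entries
    \<open>e1\<close> absorbs the commutator.\<close>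
  have "map snd listed =
    [integral_form 0 0 0 1 0 (\<kappa>\<^sub>3 / \<kappa>\<^sub>2) 0 \<kappa>\<^sub>2, integral_form 0 0 0 1 0 (\<kappa>\<^sub>1 - \<kappa>\<^sub>3 / \<kappa>\<^sub>2) \<kappa>\<^sub>2 0,
     integral_form 0 0 0 0 1 0 0 0, integral_form 0 0 0 0 1 0 0 \<kappa>\<^sub>2,
     integral_form 0 0 1 0 0 \<kappa>\<^sub>1 0 0, integral_form 0 0 1 0 0 \<kappa>\<^sub>1 \<kappa>\<^sub>2 0]" (is "_ = ?L")
    by (simp add: listed_def integral_form_def commutator_def smul_simps)
  then have "snd ` set listed = set ?L"
    by (simp only: flip: set_map)
  moreover have "integral_form d1 d2 d3 d4 d5 e1 h1 h2 \<in> integral_forms" for d1 d2 d3 d4 d5 e1 h1 h2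
    unfolding integral_forms_def by blast
  ultimately show ?thesis
    by simp
qed

section \<open>Necessary conditions on the parameters\<close>

lemma first_integral_integrable_params:
  assumes "first_integral (P1 a1 a2) (P2 b1 b2 c1 + \<kappa>\<^sub>4 \<cdot> (z * uinv^2))
             (integral_form d1 d2 d3 d4 d5 e1 h1 h2)"
  shows "(a1, a2, b1, b2, c1) \<in> set integrable_params"
proof -
  have D: "coeff (Poly_Mapping.lookup (system_derivation (P1 a1 a2) (P2 b1 b2 c1 + \<kappa>\<^sub>4 \<cdot> (z * uinv^2))
             (integral_form d1 d2 d3 d4 d5 e1 h1 h2)) w) n = 0" for w n
    using assms by (simp add: first_integral_def zero_poly_mapping.rep_eq)
  note D = D[unfolded integral_form_def power2_eq_square, simplified system_derivation_simps]
  note D = D[unfolded P1_def P2_def, simplified single_expand]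
  note D = D[simplified lookup_expand coeff_add coeff_diff coeff_minus coeff_smult
        coeff_when]
  \<comment> \<open>From here on, a fact named by a word is the vanishing of the coefficient of that word.\<close>
  have "d1 * \<kappa>\<^sub>4 = 0"
    using D[of "Suc 0" "UPowV 2 (UPow (- 2))"] by (simp add: algebra_simps)
  then have d1: "d1 = 0"
    using \<kappa>_nonzero by simp
  note D = D[unfolded d1 mult_zero_left add_0_left]
  have "(1 - (d2 + d3 + d4 + d5)) * \<kappa>\<^sub>4 = 0"
    using D[of "Suc 0" "UPowV (- 2) (UPow 2)"] by (simp add: algebra_simps)
  then have "1 - (d2 + d3 + d4 + d5) = 0"
    using \<kappa>_nonzero by simp
  then have d_sum: "d2 + d3 + d4 + d5 = 1"
    by simp
  note D = D[unfolded d_sum]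
  \<comment> \<open>The summand \<open>- a2\<close> comes from the derivative of \<open>uinv\<close>
    in the last term of the integral.\<close>
  have "(d2 + d5 - a2) * \<kappa>\<^sub>4 = 0"
    using D[of "Suc 0" "UPowV (- 1) (UPow 1)"] by (simp add: algebra_simps)
  then have a2: "a2 = d2 + d5"
    using \<kappa>_nonzero by simp
  have "(d2 + d3 - a1) * \<kappa>\<^sub>4 = 0"
    using D[of "Suc 0" "UPowV 1 (UPow (- 1))"] by (simp add: algebra_simps)
  then have a1: "a1 = d2 + d3"
    using \<kappa>_nonzero by simp
  have uuvvvu: "d2 * (a1 + b1) = 0"
    using D[of 0 "UPowV 2 (UPowV 0 (UPowV 0 (UPow 1)))"]
    by (simp add: algebra_simps neg_eq_iff_add_eq_0)
  have uuvvuv: "d3 * (a1 + b1) = 0"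
    using D[of 0 "UPowV 2 (UPowV 0 (UPowV 1 (UPow 0)))"]
    by (simp add: algebra_simps neg_eq_iff_add_eq_0)
  have vuuuvv: "d4 * (a1 + b1) = 0"
    using D[of 0 "UPowV 0 (UPowV 3 (UPowV 0 (UPow 0)))"]
    by (simp add: algebra_simps neg_eq_iff_add_eq_0)
  have uvvvuu: "d2 * (a2 + b2) = 0"
    using D[of 0 "UPowV 1 (UPowV 0 (UPowV 0 (UPow 2)))"]
    by (simp add: algebra_simps neg_eq_iff_add_eq_0)
  have vvuuuv: "d4 * (a2 + b2) = 0"
    using D[of 0 "UPowV 0 (UPowV 0 (UPowV 3 (UPow 0)))"]
    by (simp add: algebra_simps neg_eq_iff_add_eq_0)
  have vvuuvu: "d5 * (a2 + b2) = 0"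
    using D[of 0 "UPowV 0 (UPowV 0 (UPowV 2 (UPow 1)))"]
    by (simp add: algebra_simps neg_eq_iff_add_eq_0)
  have uvuvuv: "2 * (d3 * (a1 + b1 + a2 + b2)) = 0"
    using D[of 0 "UPowV 1 (UPowV 1 (UPowV 1 (UPow 0)))"]
    by (simp add: algebra_simps neg_eq_iff_add_eq_0)
  have vuvuvu: "2 * (d5 * (a1 + b1 + a2 + b2)) = 0"
    using D[of 0 "UPowV 0 (UPowV 1 (UPowV 1 (UPow 1)))"]
    by (simp add: algebra_simps neg_eq_iff_add_eq_0)
  \<comment> \<open>Distributing shows that each of \<open>d2\<close>, ..., \<open>d5\<close>
    annihilates both \<open>a1 + b1\<close> and \<open>a2 + b2\<close>. As they add up to 1, both
    sums vanish.\<close>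
  have "d3 * (a1 + b1 + a2 + b2) = 0" "d5 * (a1 + b1 + a2 + b2) = 0"
    using uvuvuv vuvuvu by simp_all
  moreover have "d * (a1 + b1 + a2 + b2) = d * (a1 + b1) + d * (a2 + b2)" for d
    by (simp add: algebra_simps)
  ultimately have "d5 * (a1 + b1) = 0" "d3 * (a2 + b2) = 0"
    using uuvvuv vvuuvu by simp_all
  then have "(d2 + d3 + d4 + d5) * (a1 + b1) = 0" "(d2 + d3 + d4 + d5) * (a2 + b2) = 0"
    using uuvvvu uuvvuv vuuuvv uvvvuu vvuuuv vvuuvu
    by (simp_all only: distrib_right) simp_all
  then have "a1 + b1 = 0" "a2 + b2 = 0"
    unfolding d_sum by simp_all
  then have b: "b1 = - a1" "b2 = - a2"
    by (simp_all add: eq_neg_iff_add_eq_0 add.commute)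
  note D = D[unfolded b]
  have uvuvvu: "d2 * a1 + a2 * d3 = 0"
    using D[of 0 "UPowV 1 (UPowV 1 (UPowV 0 (UPow 1)))"]
    by (simp add: algebra_simps neg_eq_iff_add_eq_0)
  have uvvuvu: "d2 * a2 + a1 * d5 = 0"
    using D[of 0 "UPowV 1 (UPowV 0 (UPowV 1 (UPow 1)))"]
    by (simp add: algebra_simps neg_eq_iff_add_eq_0)
  have uvvuuv: "a1 * (d2 - d4) = 0"
    using D[of 0 "UPowV 1 (UPowV 0 (UPowV 2 (UPow 0)))"]
    by (simp add: algebra_simps neg_eq_iff_add_eq_0)
  have vuuvvu: "a2 * (d2 - d4) = 0"
    using D[of 0 "UPowV 0 (UPowV 2 (UPowV 0 (UPow 1)))"]
    by (simp add: algebra_simps neg_eq_iff_add_eq_0)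
  \<comment> \<open>The words of degree at most two in \<open>v\<close> tie \<open>c1\<close> to
    \<open>h1\<close> and \<open>h2\<close>.\<close>
  have uuvuv: "a1 * h1 + d3 * (c1 + \<kappa>\<^sub>2) = 0"
    using D[of 0 "UPowV 2 (UPowV 1 (UPow 0))"]
    by (simp add: algebra_simps neg_eq_iff_add_eq_0)
  have uvuuv: "2 * h1 - 2 * (a1 * h1) - a1 * h2 + a1 * \<kappa>\<^sub>2 + c1 * d4 - d3 * \<kappa>\<^sub>2 = 0"
    using D[of 0 "UPowV 1 (UPowV 2 (UPow 0))"]
    by (simp add: algebra_simps neg_eq_iff_add_eq_0)
  have vuvuu: "a2 * h2 - d5 * (c1 + \<kappa>\<^sub>2) = 0"
    using D[of 0 "UPowV 0 (UPowV 1 (UPow 2))"]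
    by (simp add: algebra_simps neg_eq_iff_add_eq_0)
  have uuuv: "h1 * (c1 + 2 * \<kappa>\<^sub>2) = 0"
    using D[of 0 "UPowV 3 (UPow 0)"]
    by (simp add: algebra_simps neg_eq_iff_add_eq_0)
  have vuuu: "c1 * h2 = 0"
    using D[of 0 "UPowV 0 (UPow 3)"]
    by (simp add: algebra_simps neg_eq_iff_add_eq_0)
  have "(a1 = 0 \<and> a2 = 0) \<or> (a1 = 1 \<and> a2 = 0 \<and> d3 = 1 \<and> d5 = 0) \<or> (a1 = 0 \<and> a2 = 1 \<and> d3 = 0 \<and> d5 = 1)"
  proof (cases "d2 = d4")
    case False
    then show ?thesis
      using uvvuuv vuuvvu by simp
  next
    case True
    \<comment> \<open>Subtracting the two equations leaves \<open>d2 * (d3 - d5) = 0\<close>.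
      Equality of \<open>d3\<close> and \<open>d5\<close> would make the square of
      \<open>d2 + d3\<close> zero although its double is 1. So \<open>d2\<close> and
      \<open>d4\<close> vanish, and then \<open>d3 + d5 = 1\<close> and
      \<open>d3 * d5 = 0\<close>.\<close>
    have "2 * (d2 * (d3 - d5)) = (d2 * a1 + a2 * d3) - (d2 * a2 + a1 * d5)"
      by (simp add: a1 a2 algebra_simps)
    then have "d2 * (d3 - d5) = 0"
      using uvuvvu uvvuvu by simp
    moreover have "d3 \<noteq> d5"
    proof
      assume "d3 = d5"
      then have "(d2 + d3) * (d2 + d3) = d2 * a1 + a2 * d3"
        by (simp add: a1 a2 algebra_simps)
      then have "d2 + d3 = 0"
        using uvuvvu by simp
      moreover have "(d2 + d3) + (d2 + d5) = 1"
        using d_sum by (simp add: True add_ac)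
      ultimately show False
        using \<open>d3 = d5\<close> by simp
    qed
    ultimately have "d2 = 0"
      by simp
    then show ?thesis
      using True uvuvvu a1 a2 d_sum by auto
  qed
  then consider "a1 = 0" "a2 = 0" | "a1 = 1" "a2 = 0" "d3 = 1" "d5 = 0"
    | "a1 = 0" "a2 = 1" "d3 = 0" "d5 = 1"
    by blast
  then show ?thesis
  proof cases
    case 1
    have d: "d3 = - d2" "d5 = - d2"
      using a1 a2 1 by (simp_all add: eq_neg_iff_add_eq_0 add.commute)
    then have "d4 = 1 + d2"
      using d_sum by (simp add: algebra_simps)
    \<comment> \<open>Because \<open>d3 + d4 = 1\<close>, the sum of the two equations no longer
      contains any \<open>d\<close>. Then \<open>uuuv\<close> becomes
      \<open>c1 * (c1 + 2 * \<kappa>\<^sub>2) = 0\<close>.\<close>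
    then have "2 * h1 + c1 = (2 * h1 + c1 * d4 - d3 * \<kappa>\<^sub>2) + d3 * (c1 + \<kappa>\<^sub>2)"
      by (simp add: d algebra_simps)
    also have "\<dots> = 0"
      using uuvuv uvuuv 1 by simp
    finally have "2 * h1 + c1 = 0" .
    then have "c1 = 0 \<or> c1 = - 2 * \<kappa>\<^sub>2"
      using uuuv by (auto simp: add_eq_0_iff)
    then show ?thesis
      using 1 b by (auto simp: integrable_params_def)
  next
    case 2
    have "h1 = 0 \<or> c1 + 2 * \<kappa>\<^sub>2 = 0"
      using uuuv by simp
    \<comment> \<open>Here \<open>uuvuv\<close> reads
      \<open>h1 = - (c1 + \<kappa>\<^sub>2)\<close>.\<close>
    then have "c1 = - \<kappa>\<^sub>2 \<or> c1 = - 2 * \<kappa>\<^sub>2"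
      using uuvuv 2 by (auto simp: eq_neg_iff_add_eq_0)
    then show ?thesis
      using 2 b by (auto simp: integrable_params_def)
  next
    case 3
    \<comment> \<open>The mirror image of the second case: reversing words exchanges
      \<open>c1\<close> with \<open>- 2 * \<kappa>\<^sub>2 - c1\<close>, and
      \<open>h2 = c1 + \<kappa>\<^sub>2\<close>.\<close>
    then have "c1 = 0 \<or> c1 = - \<kappa>\<^sub>2"
      using vuvuu vuuu by (auto simp: eq_neg_iff_add_eq_0)
    then show ?thesis
      using 3 b by (auto simp: integrable_params_def)
  qed
qed

section \<open>The classification\<close>

theorem proposition6:
  shows "{(F1, F2) \<in> systems. \<exists>J \<in> integral_forms. first_integral F1 F2 J} = fst ` set listed
    \<and> card {(F1, F2) \<in> systems. \<exists>J \<in> integral_forms. first_integral F1 F2 J} = 6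
    \<and> (\<forall>((F1, F2), J) \<in> set listed. J \<in> integral_forms \<and> first_integral F1 F2 J)"
proof -
  let ?S = "{(F1, F2) \<in> systems. \<exists>J \<in> integral_forms. first_integral F1 F2 J}"
  have fst_listed: "fst ` set listed = param_system ` set integrable_params"
    using map_fst_listed by (metis set_map)
  have listed: "J \<in> integral_forms \<and> first_integral F1 F2 J" if "((F1, F2), J) \<in> set listed" for F1 F2 J
  proof
    show "J \<in> integral_forms"
      using imageI[OF that, of snd] listed_integral_forms by auto
    show "first_integral F1 F2 J"
      using bspec[OF listed_first_integral that] by simp
  qed
  have "?S \<subseteq> param_system ` set integrable_params"
  proof
    fix F assume "F \<in> ?S"
    then have "F \<in> systems" "\<exists>J \<in> integral_forms. first_integral (fst F) (snd F) J"
      by auto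
    then obtain p J where F: "F = param_system p" and "J \<in> integral_forms"
      and "first_integral (fst F) (snd F) J"
      unfolding systems_eq_range by blast
    then have "p \<in> set integrable_params"
      by (cases p) (auto simp: param_system_def system_def integral_forms_def
          intro: first_integral_integrable_params)
    then show "F \<in> param_system ` set integrable_params"
      using F by blast
  qed
  moreover have "fst ` set listed \<subseteq> ?S"
  proof
    fix F assume F: "F \<in> fst ` set listed"
    then obtain J where "((fst F, snd F), J) \<in> set listed"
      by auto
    from listed[OF this] have "\<exists>J \<in> integral_forms. first_integral (fst F) (snd F) J"
      by blast
    moreover have "F \<in> systems"
      using F unfolding fst_listed systems_eq_range by blast
    ultimately show "F \<in> ?S"
      by (simp add: case_prod_unfold)
  qed
  ultimately have S: "?S = fst ` set listed"
    using fst_listed by simp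
  \<comment> \<open>Counting systems reduces to counting parameter tuples by injectivity of
    \<open>param_system\<close>.\<close>
  have "card (fst ` set listed) = card (set integrable_params)"
    unfolding fst_listed by (intro card_image inj_on_subset[OF inj_param_system]) simp
  also have "\<dots> = 6"
    using distinct_integrable_params by (simp add: distinct_card) (simp add: integrable_params_def)
  finally have "card (fst ` set listed) = 6" .
  moreover have "\<forall>((F1, F2), J) \<in> set listed. J \<in> integral_forms \<and> first_integral F1 F2 J"
    using listed by blast
  ultimately show ?thesis
    unfolding S by blast
qed

end
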